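(* Consider the bases $[0312]$ (elements $A^{\uparrow\uparrow}_i,B^{\uparrow\uparrow}_i,\psi^{\uparrow\uparrow}_{i+1}$, $i\in\mathbb{N}$) and $[3021]$ (elements $A^{\downarrow\downarrow}_i,B^{\downarrow\downarrow}_i,\psi^{\downarrow\downarrow}_{i+1}$, $i\in\mathbb{N}$) of the Onsager Lie algebra $O$. The transition matrix from $[0312]$ to $[3021]$ is given by $$A^{\downarrow\downarrow}_i=-A^{\uparrow\uparrow}_i,\qquad B^{\downarrow\downarrow}_i=-B^{\uparrow\uparrow}_i,\qquad \psi^{\downarrow\downarrow}_{i+1}=-A^{\uparrow\uparrow}_i-B^{\uparrow\uparrow}_i+\psi^{\uparrow\uparrow}_{i+1}\qquad(i\in\mathbb{N}).$$ Moreover, the transition matrix from $[3021]$ to $[0312]$ is given by $$A^{\uparrow\uparrow}_i=-A^{\downarrow\downarrow}_i,\qquad B^{\uparrow\uparrow}_i=-B^{\downarrow\downarrow}_i,\qquad \psi^{\uparrow\uparrow}_{i+1}=-A^{\downarrow\downarrow}_i-B^{\downarrow\downarrow}_i+\psi^{\downarrow\downarrow}_{i+1}\qquad(i\in\mathbb{N}).$$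
   Context: $\mathbb{F}$ is a field of characteristic zero; $\mathbb{N}=\{0,1,2,\ldots\}$; tensor products are over $\mathbb{F}$. $\mathfrak{sl}_2$ is the Lie algebra over $\mathbb{F}$ with basis $e,f,h$ and $[h,e]=2e$, $[h,f]=-2f$, $[e,f]=h$; $x=2e-h$, $y=-2f-h$, $z=h$ is its equitable basis. $\mathcal{A}=\mathbb{F}[t,t^{-1},(t-1)^{-1}]$ with $t$ an indeterminate. $L(\mathfrak{sl}_2)^+=\mathfrak{sl}_2\otimes\mathcal{A}$ with Lie bracket $[u\otimes a,v\otimes b]=[u,v]\otimes ab$ and right $\mathcal{A}$-module structure $(u\otimes a)b=u\otimes ab$. The Onsager Lie algebra $O$ (generators $A,B$; relations $[A,[A,[A,B]]]=4[A,B]$, $[B,[B,[B,A]]]=4[B,A]$) is identified with the Lie subalgebra of $L(\mathfrak{sl}_2)^+$ generated by $A=x\otimes1$ and $B=y\otimes t+z\otimes(t-1)$. Bases of $O$ (indexed by $i\in\mathbb{N}$): $[0312]$: $A^{\uparrow\uparrow}_i=x\otimes(t-1)^i$, $B^{\uparrow\uparrow}_i=(y\otimes t+z\otimes(t-1))(t-1)^i$, $\psi^{\uparrow\uparrow}_{i+1}=z\otimes(t-1)^{i+1}$. $[3021]$: $A^{\downarrow\downarrow}_i=-x\otimes(t-1)^i$, $B^{\downarrow\downarrow}_i=(-y\otimes t-z\otimes(t-1))(t-1)^i$, $\psi^{\downarrow\downarrow}_{i+1}=(-x\otimes1-y\otimes t)(t-1)^i$. The transition matrix from one basis to another is described by expressing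 each element of the second basis as a linear combination of the elements of the first. *)

theory Defs
  imports
    "HOL-Computational_Algebra.Polynomial"
    "HOL-Computational_Algebra.Fraction_Field"
begin

section \<open>The algebra of Laurent-type polynomials\<close>

text \<open>
  \<open>'a laurent01\<close> is \<open>F[t, t\<^sup>-\<^sup>1, (t - 1)\<^sup>-\<^sup>1]\<close>, realised as the
  subring of the field of rational functions over \<open>F\<close> that consists of the fractions
  with denominator \<open>t ^ m * (t - 1) ^ n\<close>.
\<close>

typedef (overloaded) ('a :: field) laurent01 =
  "{r :: 'a poly fract. \<exists>p m n. r = Fract p ([:0, 1:] ^ m * [:-1, 1:] ^ n)}"
  by blast

setup_lifting type_definition_laurent01

instantiation laurent01 :: (field) comm_ring_1
begin

lift_definition zero_laurent01 :: "'a laurent01" is 0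
  by (rule exI[of _ 0]) (auto simp: Zero_fract_def eq_fract)

lift_definition one_laurent01 :: "'a laurent01" is 1
  by (rule exI[of _ 1], rule exI[of _ 0], rule exI[of _ 0]) (simp add: One_fract_def)

lift_definition uminus_laurent01 :: "'a laurent01 \<Rightarrow> 'a laurent01" is uminus
  by (metis minus_fract)

lift_definition plus_laurent01 :: "'a laurent01 \<Rightarrow> 'a laurent01 \<Rightarrow> 'a laurent01" is plus
proof -
  fix r s :: "'a poly fract"
  assume "\<exists>p m n. r = Fract p ([:0, 1:] ^ m * [:-1, 1:] ^ n)"
  then obtain p m n where r: "r = Fract p ([:0, 1:] ^ m * [:-1, 1:] ^ n)" by blast
  assume "\<exists>p m n. s = Fract p ([:0, 1:] ^ m * [:-1, 1:] ^ n)"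
  then obtain q k l where s: "s = Fract q ([:0, 1:] ^ k * [:-1, 1:] ^ l)" by blast
  have "r + s = Fract (p * ([:0, 1:] ^ k * [:-1, 1:] ^ l) + q * ([:0, 1:] ^ m * [:-1, 1:] ^ n))
                 ([:0, 1:] ^ (m + k) * [:-1, 1:] ^ (n + l))"
    unfolding r s by (subst add_fract) (simp_all add: power_add mult_ac)
  then show "\<exists>p m n. r + s = Fract p ([:0, 1:] ^ m * [:-1, 1:] ^ n)" by blast
qed

lift_definition minus_laurent01 :: "'a laurent01 \<Rightarrow> 'a laurent01 \<Rightarrow> 'a laurent01" is minus
proof -
  fix r s :: "'a poly fract"
  assume "\<exists>p m n. r = Fract p ([:0, 1:] ^ m * [:-1, 1:] ^ n)"
  then obtain p m n where r: "r = Fract p ([:0, 1:] ^ m * [:-1, 1:] ^ n)" by blast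
  assume "\<exists>p m n. s = Fract p ([:0, 1:] ^ m * [:-1, 1:] ^ n)"
  then obtain q k l where s: "s = Fract q ([:0, 1:] ^ k * [:-1, 1:] ^ l)" by blast
  have "r - s = Fract (p * ([:0, 1:] ^ k * [:-1, 1:] ^ l) - q * ([:0, 1:] ^ m * [:-1, 1:] ^ n))
                 ([:0, 1:] ^ (m + k) * [:-1, 1:] ^ (n + l))"
    unfolding r s by (subst diff_fract) (simp_all add: power_add mult_ac)
  then show "\<exists>p m n. r - s = Fract p ([:0, 1:] ^ m * [:-1, 1:] ^ n)" by blast
qed

lift_definition times_laurent01 :: "'a laurent01 \<Rightarrow> 'a laurent01 \<Rightarrow> 'a laurent01" is times
proof -
  fix r s :: "'a poly fract"
  assume "\<exists>p m n. r = Fract p ([:0, 1:] ^ m * [:-1, 1:] ^ n)"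
  then obtain p m n where r: "r = Fract p ([:0, 1:] ^ m * [:-1, 1:] ^ n)" by blast
  assume "\<exists>p m n. s = Fract p ([:0, 1:] ^ m * [:-1, 1:] ^ n)"
  then obtain q k l where s: "s = Fract q ([:0, 1:] ^ k * [:-1, 1:] ^ l)" by blast
  have "r * s = Fract (p * q) ([:0, 1:] ^ (m + k) * [:-1, 1:] ^ (n + l))"
    unfolding r s by (subst mult_fract) (simp add: power_add mult_ac)
  then show "\<exists>p m n. r * s = Fract p ([:0, 1:] ^ m * [:-1, 1:] ^ n)" by blast
qed

instance
  by standard (transfer; simp add: algebra_simps)+

end

lift_definition indet :: "'a :: field laurent01" is "Fract [:0, 1:] 1"
  by (rule exI[of _ "[:0, 1:]"], rule exI[of _ 0], rule exI[of _ 0]) simp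

lift_definition of_scalar :: "'a :: field \<Rightarrow> 'a laurent01" is "\<lambda>c. Fract [:c:] 1"
  by (rule exI, rule exI[of _ 0], rule exI[of _ 0]) simp

lemma indet_invertible: "\<exists>s. indet * s = (1 :: 'a :: field laurent01)"
proof (transfer, intro bexI)
  show "Fract [:0, 1:] 1 * Fract 1 [:0, 1:] = (1 :: 'a poly fract)"
    by (simp add: One_fract_def eq_fract)
  show "Fract 1 [:0, 1:] \<in> {r :: 'a poly fract. \<exists>p m n. r = Fract p ([:0, 1:] ^ m * [:-1, 1:] ^ n)}"
    by (rule CollectI, rule exI[of _ 1], rule exI[of _ 1], rule exI[of _ 0]) simp
qed

lemma indet_minus_1_invertible: "\<exists>s. (indet - 1) * s = (1 :: 'a :: field laurent01)"
proof (transfer, intro bexI)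
  show "(Fract [:0, 1:] 1 - 1) * Fract 1 [:-1, 1:] = (1 :: 'a poly fract)"
    by (simp add: One_fract_def eq_fract one_pCons)
  show "Fract 1 [:-1, 1:] \<in> {r :: 'a poly fract. \<exists>p m n. r = Fract p ([:0, 1:] ^ m * [:-1, 1:] ^ n)}"
    by (rule CollectI, rule exI[of _ 1], rule exI[of _ 0], rule exI[of _ 1]) simp
qed

lemma of_scalar_simps [simp]:
  "of_scalar 0 = 0" "of_scalar 1 = 1"
  "of_scalar (c + d) = of_scalar c + of_scalar d"
  "of_scalar (c * d) = of_scalar c * of_scalar d"
  "of_scalar (- c) = - of_scalar c"
  "of_scalar (c - d) = of_scalar c - of_scalar d"
  by (transfer; simp add: Zero_fract_def One_fract_def one_pCons eq_fract)+


section \<open>The Lie algebra \<open>sl\<^sub>2\<close> and its equitable basis\<close>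

text \<open>\<open>Sl2 a b c\<close> stands for \<open>a e + b f + c h\<close>.\<close>

datatype 'r sl2 = Sl2 (coord_e: 'r) (coord_f: 'r) (coord_h: 'r)

instantiation sl2 :: (comm_ring_1) ab_group_add
begin
definition "0 = Sl2 0 0 0"
definition "u + v = Sl2 (coord_e u + coord_e v) (coord_f u + coord_f v) (coord_h u + coord_h v)"
definition "- u = Sl2 (- coord_e u) (- coord_f u) (- coord_h u)"
definition "u - v = Sl2 (coord_e u - coord_e v) (coord_f u - coord_f v) (coord_h u - coord_h v)"
instance
  by standard
    (simp_all add: zero_sl2_def plus_sl2_def uminus_sl2_def minus_sl2_def algebra_simps)
end

definition smult_sl2 :: "'r :: comm_ring_1 \<Rightarrow> 'r sl2 \<Rightarrow> 'r sl2" where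
  "smult_sl2 c u = Sl2 (c * coord_e u) (c * coord_f u) (c * coord_h u)"

text \<open>
  The bilinear extension of \<open>[h, e] = 2e\<close>, \<open>[h, f] = -2f\<close>, \<open>[e, f] = h\<close>; see
  \<open>bracket_basis\<close> and \<open>bracket_lie\<close> below.
\<close>

definition bracket :: "'r :: comm_ring_1 sl2 \<Rightarrow> 'r sl2 \<Rightarrow> 'r sl2" where
  "bracket u v = Sl2
     (2 * (coord_h u * coord_e v - coord_e u * coord_h v))
     (- 2 * (coord_h u * coord_f v - coord_f u * coord_h v))
     (coord_e u * coord_f v - coord_f u * coord_e v)"

definition sl2_e :: "'r :: comm_ring_1 sl2" where "sl2_e = Sl2 1 0 0"
definition sl2_f :: "'r :: comm_ring_1 sl2" where "sl2_f = Sl2 0 1 0"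
definition sl2_h :: "'r :: comm_ring_1 sl2" where "sl2_h = Sl2 0 0 1"

definition sl2_x :: "'r :: comm_ring_1 sl2" where "sl2_x = smult_sl2 2 sl2_e - sl2_h"
definition sl2_y :: "'r :: comm_ring_1 sl2" where "sl2_y = smult_sl2 (- 2) sl2_f - sl2_h"
definition sl2_z :: "'r :: comm_ring_1 sl2" where "sl2_z = sl2_h"

lemmas sl2_defs = zero_sl2_def plus_sl2_def uminus_sl2_def minus_sl2_def smult_sl2_def
  bracket_def sl2_e_def sl2_f_def sl2_h_def sl2_x_def sl2_y_def sl2_z_def

lemma bracket_basis:
  "bracket sl2_h sl2_e = smult_sl2 2 sl2_e"
  "bracket sl2_h sl2_f = smult_sl2 (- 2) sl2_f"
  "bracket sl2_e sl2_f = sl2_h"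
  by (simp_all add: sl2_defs)

lemma bracket_lie:
  "bracket (u + u') v = bracket u v + bracket u' v"
  "bracket u (v + v') = bracket u v + bracket u v'"
  "bracket (smult_sl2 c u) v = smult_sl2 c (bracket u v)"
  "bracket u (smult_sl2 c v) = smult_sl2 c (bracket u v)"
  "bracket u u = 0"
  "bracket u (bracket v w) + bracket v (bracket w u) + bracket w (bracket u v) = 0"
  by (simp_all add: sl2_defs algebra_simps)


section \<open>The Lie algebra \<open>sl\<^sub>2 \<otimes> F[t, t\<^sup>-\<^sup>1, (t - 1)\<^sup>-\<^sup>1]\<close>\<close>

text \<open>
  As \<open>e, f, h\<close> is a basis of \<open>sl\<^sub>2\<close>, the tensor product over \<open>F\<close> is realised by the
  elements \<open>e \<otimes> a + f \<otimes> b + h \<otimes> c\<close> with coefficients \<open>a, b, c\<close> in the algebra. The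
  lemmas \<open>tensor_bilinear\<close> and \<open>tensor_universal\<close> are the universal property of the
  tensor product, and \<open>bracket_tensor\<close> says that \<open>bracket\<close> is the intended Lie bracket.
\<close>

type_synonym 'a loop_sl2 = "'a laurent01 sl2"

definition scale_loop :: "'a :: field \<Rightarrow> 'a loop_sl2 \<Rightarrow> 'a loop_sl2" where
  "scale_loop c w = smult_sl2 (of_scalar c) w"

definition tensor :: "'a :: field sl2 \<Rightarrow> 'a laurent01 \<Rightarrow> 'a loop_sl2"  (infix \<open>\<otimes>\<close> 75) where
  "u \<otimes> a = Sl2 (of_scalar (coord_e u) * a) (of_scalar (coord_f u) * a) (of_scalar (coord_h u) * a)"

definition act :: "'a :: field loop_sl2 \<Rightarrow> 'a laurent01 \<Rightarrow> 'a loop_sl2"  (infixl \<open>\<cdot>\<close> 75) where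
  "w \<cdot> b = smult_sl2 b w"

interpretation loop: vector_space "scale_loop :: 'a :: field \<Rightarrow> 'a loop_sl2 \<Rightarrow> 'a loop_sl2"
  by unfold_locales (simp_all add: scale_loop_def sl2_defs algebra_simps)

lemma tensor_bilinear:
  "(u + u') \<otimes> a = u \<otimes> a + u' \<otimes> a"
  "u \<otimes> (a + a') = u \<otimes> a + u \<otimes> a'"
  "smult_sl2 c u \<otimes> a = scale_loop c (u \<otimes> a)"
  "u \<otimes> (of_scalar c * a) = scale_loop c (u \<otimes> a)"
  by (simp_all add: tensor_def scale_loop_def sl2_defs algebra_simps)

lemma act_tensor: "(u \<otimes> a) \<cdot> b = u \<otimes> (a * b)"
  by (simp add: tensor_def act_def sl2_defs algebra_simps)

lemma bracket_tensor: "bracket (u \<otimes> a) (v \<otimes> b) = bracket u v \<otimes> (a * b)"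
proof -
  have "of_scalar 2 = (2 :: 'a laurent01)"
    using of_scalar_simps(3)[of 1 "1 :: 'a"] by (simp del: of_scalar_simps(3))
  then show ?thesis
    by (simp add: tensor_def sl2_defs algebra_simps)
qed

lemma tensor_universal:
  fixes scaleW :: "'a :: field \<Rightarrow> 'w :: ab_group_add \<Rightarrow> 'w"
    and \<beta> :: "'a sl2 \<Rightarrow> 'a laurent01 \<Rightarrow> 'w"
  assumes W: "vector_space scaleW"
    and add1: "\<And>u u' a. \<beta> (u + u') a = \<beta> u a + \<beta> u' a"
    and add2: "\<And>u a a'. \<beta> u (a + a') = \<beta> u a + \<beta> u a'"
    and scale1: "\<And>c u a. \<beta> (smult_sl2 c u) a = scaleW c (\<beta> u a)"
    and scale2: "\<And>c u a. \<beta> u (of_scalar c * a) = scaleW c (\<beta> u a)"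
  shows "\<exists>!\<phi>. Vector_Spaces.linear scale_loop scaleW \<phi> \<and> (\<forall>u a. \<phi> (u \<otimes> a) = \<beta> u a)"
proof -
  interpret W: vector_space scaleW by (fact W)
  have dec_u: "u = smult_sl2 (coord_e u) sl2_e + (smult_sl2 (coord_f u) sl2_f
      + smult_sl2 (coord_h u) sl2_h)" for u :: "'a sl2"
    by (simp add: sl2_defs)
  have dec_w: "w = sl2_e \<otimes> coord_e w + (sl2_f \<otimes> coord_f w + sl2_h \<otimes> coord_h w)"
    for w :: "'a loop_sl2"
    by (simp add: sl2_defs tensor_def)
  define \<phi> where "\<phi> w = \<beta> sl2_e (coord_e w) + (\<beta> sl2_f (coord_f w) + \<beta> sl2_h (coord_h w))" for w
  have lin: "Vector_Spaces.linear scale_loop scaleW \<phi>"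
    by unfold_locales
      (simp_all add: \<phi>_def plus_sl2_def smult_sl2_def scale_loop_def add2 scale2
        W.scale_right_distrib W.scale_left_distrib add_ac)
  have val: "\<phi> (u \<otimes> a) = \<beta> u a" for u a
    by (subst (2) dec_u) (simp add: \<phi>_def tensor_def add1 scale1 scale2)
  show ?thesis
  proof (intro ex1I conjI allI)
    fix \<phi>' assume *: "Vector_Spaces.linear scale_loop scaleW \<phi>' \<and> (\<forall>u a. \<phi>' (u \<otimes> a) = \<beta> u a)"
    then interpret \<phi>': Vector_Spaces.linear scale_loop scaleW \<phi>' by blast
    show "\<phi>' = \<phi>"
    proof
      fix w
      show "\<phi>' w = \<phi> w"
        by (subst dec_w) (use * in \<open>simp add: \<phi>'.add \<phi>_def\<close>)
    qed
  qed (use lin val in auto)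
qed


section \<open>The Onsager Lie algebra and the two bases\<close>

definition lie_subalgebra :: "'a :: field loop_sl2 set \<Rightarrow> bool" where
  "lie_subalgebra S \<longleftrightarrow> loop.subspace S \<and> (\<forall>u\<in>S. \<forall>v\<in>S. bracket u v \<in> S)"

definition onsager_A :: "'a :: field loop_sl2" where
  "onsager_A = sl2_x \<otimes> 1"

definition onsager_B :: "'a :: field loop_sl2" where
  "onsager_B = sl2_y \<otimes> indet + sl2_z \<otimes> (indet - 1)"

definition onsager :: "'a :: field loop_sl2 set" where
  "onsager = lie_subalgebra hull {onsager_A, onsager_B}"

lemma onsager_lie_subalgebra: "lie_subalgebra onsager"
  unfolding onsager_def
  by (rule hull_in) (auto simp: lie_subalgebra_def intro!: loop.subspace_Inter)

text \<open>
  The elements \<open>\<psi>\<close> are indexed from \<open>1\<close>; the value of \<open>psi_uu\<close> and \<open>psi_dd\<close>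
  at \<open>0\<close> has no meaning.
\<close>

definition A_uu :: "nat \<Rightarrow> 'a :: field loop_sl2" where
  "A_uu i = sl2_x \<otimes> (indet - 1) ^ i"

definition B_uu :: "nat \<Rightarrow> 'a :: field loop_sl2" where
  "B_uu i = (sl2_y \<otimes> indet + sl2_z \<otimes> (indet - 1)) \<cdot> (indet - 1) ^ i"

definition psi_uu :: "nat \<Rightarrow> 'a :: field loop_sl2" where
  "psi_uu n = sl2_z \<otimes> (indet - 1) ^ n"

definition A_dd :: "nat \<Rightarrow> 'a :: field loop_sl2" where
  "A_dd i = - (sl2_x \<otimes> (indet - 1) ^ i)"

definition B_dd :: "nat \<Rightarrow> 'a :: field loop_sl2" where
  "B_dd i = (- (sl2_y \<otimes> indet) - sl2_z \<otimes> (indet - 1)) \<cdot> (indet - 1) ^ i"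

definition psi_dd :: "nat \<Rightarrow> 'a :: field loop_sl2" where
  "psi_dd n = (- (sl2_x \<otimes> 1) - sl2_y \<otimes> indet) \<cdot> (indet - 1) ^ (n - 1)"

datatype onsager_index = Idx_A nat | Idx_B nat | Idx_psi nat

fun basis_0312 :: "onsager_index \<Rightarrow> 'a :: field loop_sl2" where
  "basis_0312 (Idx_A i) = A_uu i"
| "basis_0312 (Idx_B i) = B_uu i"
| "basis_0312 (Idx_psi i) = psi_uu (i + 1)"

fun basis_3021 :: "onsager_index \<Rightarrow> 'a :: field loop_sl2" where
  "basis_3021 (Idx_A i) = A_dd i"
| "basis_3021 (Idx_B i) = B_dd i"
| "basis_3021 (Idx_psi i) = psi_dd (i + 1)"

definition basis_family_of :: "('i \<Rightarrow> 'a :: field loop_sl2) \<Rightarrow> 'a loop_sl2 set \<Rightarrow> bool" where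
  "basis_family_of b V \<longleftrightarrow>
     inj b \<and> loop.independent (range b) \<and> loop.span (range b) = V"

end

theory Submission
  imports Defs
begin

text \<open>
  With \<open>s = t - 1\<close>, the brackets of \<open>A\<^sub>i = A_uu i\<close>, \<open>B\<^sub>i = B_uu i\<close>,
  \<open>\<psi>\<^sub>i = psi_uu i\<close> are combinations of the same elements, so that their span contains
  the Onsager algebra. Conversely \<open>[A\<^sub>i, B\<^sub>0]\<close> yields \<open>\<psi>\<^sub>i\<^sub>+\<^sub>1\<close>, and bracketing with
  \<open>\<psi>\<^sub>1\<close> raises the index of \<open>A\<^sub>i\<close> and \<open>B\<^sub>i\<close> by one, so all these elements are generated by
  \<open>A\<^sub>0\<close> and \<open>B\<^sub>0\<close>. Independence holds because \<open>x \<otimes> p(s) + (y \<otimes> t + z \<otimes> s) q(s) + z \<otimes> s r(s)\<close>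
  determines the polynomials \<open>p, q, r\<close>.
\<close>

section \<open>Polynomials in \<open>t - 1\<close>\<close>

lift_definition poly_t_minus_1 :: "'a :: field poly \<Rightarrow> 'a laurent01"
  is "\<lambda>p. Fract (pcompose p [:-1, 1:]) 1"
  by (rule exI, rule exI[of _ 0], rule exI[of _ 0]) simp

lemma poly_t_minus_1_add: "poly_t_minus_1 (p + q) = poly_t_minus_1 p + poly_t_minus_1 q"
  by transfer (simp add: pcompose_add)

lemma poly_t_minus_1_mult: "poly_t_minus_1 (p * q) = poly_t_minus_1 p * poly_t_minus_1 q"
  by transfer (simp add: pcompose_mult)

lemma poly_t_minus_1_const: "poly_t_minus_1 [:c:] = of_scalar c"
  by transfer simp

lemma poly_t_minus_1_smult: "poly_t_minus_1 (smult c p) = of_scalar c * poly_t_minus_1 p"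
  using poly_t_minus_1_mult[of "[:c:]" p] by (simp add: poly_t_minus_1_const)

lemma poly_t_minus_1_minus: "poly_t_minus_1 (- p) = - poly_t_minus_1 p"
  by transfer (simp add: pcompose_uminus)

text \<open>Composition with \<open>[:-1, 1:]\<close>, which has positive degree, kills no nonzero
  polynomial. Hence F[s] embeds into the algebra via s = t - 1.\<close>

lemma poly_t_minus_1_eq_0_iff: "poly_t_minus_1 p = 0 \<longleftrightarrow> p = 0"
  by transfer (auto simp: Zero_fract_def eq_fract pcompose_eq_0)

lemma poly_t_minus_1_0 [simp]: "poly_t_minus_1 0 = 0"
  by (simp add: poly_t_minus_1_eq_0_iff)

lemma poly_t_minus_1_linear: "poly_t_minus_1 [:0, 1:] = indet - 1"
  by (simp add: Rep_laurent01_inject[symmetric] poly_t_minus_1.rep_eq indet.rep_eq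
      minus_laurent01.rep_eq one_laurent01.rep_eq One_fract_def one_pCons pcompose_pCons)

lemma poly_t_minus_1_monom: "poly_t_minus_1 (monom 1 i) = (indet - 1) ^ i"
proof (induction i)
  case 0
  then show ?case
    using poly_t_minus_1_const[of 1] by (simp add: monom_0)
next
  case (Suc i)
  have "monom 1 (Suc i) = [:0, 1:] * monom (1 :: 'a) i"
    by (simp add: monom_Suc)
  then show ?case
    by (simp only: poly_t_minus_1_mult poly_t_minus_1_linear Suc power_Suc)
qed

text \<open>Lets units be cancelled with only the \<open>comm_ring_1\<close> structure at hand; the
  units in question are numerals, \<open>indet\<close> and \<open>indet - 1\<close>.\<close>

lemma mult_left_eq_0_iff_of_invertible:
  fixes a b :: "'r :: comm_ring_1"
  assumes "\<exists>c. a * c = 1"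
  shows "a * b = 0 \<longleftrightarrow> b = 0"
  using assms by (metis mult.assoc mult.commute mult_1 mult_zero_right)

lemma of_scalar_numeral: "of_scalar (numeral n) = numeral n"
proof -
  have "of_scalar (of_nat k :: 'a) = of_nat k" for k
    by (induction k) simp_all
  from this[of "numeral n"] show ?thesis by simp
qed

lemma numeral_mult_laurent01_eq_0_iff:
  fixes a :: "'a :: field_char_0 laurent01"
  shows "numeral n * a = 0 \<longleftrightarrow> a = 0"
proof (rule mult_left_eq_0_iff_of_invertible)
  have "numeral n * of_scalar (inverse (numeral n)) = of_scalar (numeral n * inverse (numeral n) :: 'a)"
    by (simp only: of_scalar_simps of_scalar_numeral)
  then show "\<exists>c. numeral n * c = (1 :: 'a laurent01)"
    by auto
qed

section \<open>Linear independence\<close>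

text \<open>Relations are indexed by the family rather than by its range, so the hypothesis also
  excludes repeated vectors.\<close>

lemma (in vector_space) independent_family:
  assumes "\<And>S u k. finite S \<Longrightarrow> (\<Sum>k\<in>S. scale (u k) (b k)) = 0 \<Longrightarrow> k \<in> S \<Longrightarrow> u k = 0"
  shows "inj b" "independent (range b)"
proof -
  show inj: "inj b"
  proof (rule injI, rule ccontr)
    fix i j assume eq: "b i = b j" and "i \<noteq> j"
    \<comment> \<open>A repetition \<open>b i = b j\<close> would give a relation with coefficients
      1 and -1.\<close>
    then have "(\<Sum>k\<in>{i, j}. scale (if k = i then 1 else - 1) (b k)) = 0"
      by simp
    from assms[OF _ this, of i] show False by simp
  qed
  show "independent (range b)"
    unfolding independent_explicit_module
  proof (intro allI impI)
    fix T u v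
    assume T: "finite T" "T \<subseteq> range b" and zero: "(\<Sum>v\<in>T. scale (u v) v) = 0" and v: "v \<in> T"
    obtain S where S: "T = b ` S"
      using T(2) by (auto simp: subset_image_iff)
    have inj_S: "inj_on b S"
      using inj by (rule inj_on_subset) simp
    have "finite S"
      using T(1) inj_S S by (simp add: finite_image_iff)
    moreover have "(\<Sum>k\<in>S. scale (u (b k)) (b k)) = 0"
      using zero by (simp add: S sum.reindex[OF inj_S])
    ultimately show "u v = 0"
      using v assms[of S "\<lambda>k. u (b k)"] by (auto simp: S)
  qed
qed

text \<open>The coefficients of s^i in \<open>p\<close>, \<open>q\<close>, \<open>r\<close> are
  those of \<open>A_uu i\<close>, \<open>B_uu i\<close>, \<open>psi_uu (i + 1)\<close>. The factor
  \<open>indet - 1\<close> before the last polynomial accounts for the index shift of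
  \<open>psi_uu\<close>.\<close>

definition loop_of_polys :: "'a :: field poly \<Rightarrow> 'a poly \<Rightarrow> 'a poly \<Rightarrow> 'a loop_sl2" where
  "loop_of_polys p q r =
     sl2_x \<otimes> poly_t_minus_1 p
     + (sl2_y \<otimes> indet + sl2_z \<otimes> (indet - 1)) \<cdot> poly_t_minus_1 q
     + sl2_z \<otimes> ((indet - 1) * poly_t_minus_1 r)"

lemmas loop_defs = tensor_def act_def scale_loop_def sl2_defs

lemma loop_of_polys_0: "loop_of_polys 0 0 0 = 0"
  by (simp add: loop_of_polys_def loop_defs)

lemma loop_of_polys_add:
  "loop_of_polys (p + p') (q + q') (r + r') = loop_of_polys p q r + loop_of_polys p' q' r'"
  by (simp add: loop_of_polys_def loop_defs poly_t_minus_1_add algebra_simps)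

lemma loop_of_polys_smult:
  "loop_of_polys (smult c p) (smult c q) (smult c r) = scale_loop c (loop_of_polys p q r)"
  by (simp add: loop_of_polys_def loop_defs poly_t_minus_1_smult algebra_simps)

lemma loop_of_polys_sum:
  "(\<Sum>k\<in>S. scale_loop (u k) (loop_of_polys (p k) (q k) (r k))) =
     loop_of_polys (\<Sum>k\<in>S. smult (u k) (p k)) (\<Sum>k\<in>S. smult (u k) (q k)) (\<Sum>k\<in>S. smult (u k) (r k))"
  by (induction S rule: infinite_finite_induct)
    (simp_all add: loop_of_polys_0 loop_of_polys_add loop_of_polys_smult)

text \<open>Since x = 2e - h and y = -2f - h, the e- and f-coordinates are 2p(s) and -2t q(s). Once
  p and q vanish, the h-coordinate is s r(s). Here 2 (in characteristic zero), t and s = t - 1 are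
  units.\<close>

lemma loop_of_polys_eq_0D:
  fixes p q r :: "'a :: field_char_0 poly"
  assumes "loop_of_polys p q r = 0"
  shows "p = 0" "q = 0" "r = 0"
proof -
  from assms have "2 * poly_t_minus_1 p = 0"
    by (simp add: loop_of_polys_def loop_defs of_scalar_numeral)
  then show p: "p = 0"
    by (simp only: numeral_mult_laurent01_eq_0_iff poly_t_minus_1_eq_0_iff)
  from assms have "2 * (indet * poly_t_minus_1 q) = 0"
    by (simp add: loop_of_polys_def loop_defs of_scalar_numeral algebra_simps)
  then show q: "q = 0"
    by (simp only: numeral_mult_laurent01_eq_0_iff poly_t_minus_1_eq_0_iff
        mult_left_eq_0_iff_of_invertible[OF indet_invertible])
  from assms have "(indet - 1) * poly_t_minus_1 r = 0"
    by (simp add: p q loop_of_polys_def loop_defs)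
  then show "r = 0"
    by (simp only: poly_t_minus_1_eq_0_iff
        mult_left_eq_0_iff_of_invertible[OF indet_minus_1_invertible])
qed

text \<open>Together with \<open>delta_B\<close> and \<open>delta_psi\<close>, this gives the
  polynomial coordinates of \<open>basis_0312\<close>.\<close>

fun delta_A :: "onsager_index \<Rightarrow> 'a :: field poly" where
  "delta_A (Idx_A i) = monom 1 i"
| "delta_A _ = 0"

fun delta_B :: "onsager_index \<Rightarrow> 'a :: field poly" where
  "delta_B (Idx_B i) = monom 1 i"
| "delta_B _ = 0"

fun delta_psi :: "onsager_index \<Rightarrow> 'a :: field poly" where
  "delta_psi (Idx_psi i) = monom 1 i"
| "delta_psi _ = 0"

lemma coeff_sum_delta:
  assumes "finite S"
  shows "coeff (\<Sum>k\<in>S. smult (u k) (delta_A k)) i = (if Idx_A i \<in> S then u (Idx_A i) else 0)"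
    and "coeff (\<Sum>k\<in>S. smult (u k) (delta_B k)) i = (if Idx_B i \<in> S then u (Idx_B i) else 0)"
    and "coeff (\<Sum>k\<in>S. smult (u k) (delta_psi k)) i = (if Idx_psi i \<in> S then u (Idx_psi i) else 0)"
proof -
  have *: "coeff (delta_A k :: 'a poly) i = (if k = Idx_A i then 1 else 0)"
    "coeff (delta_B k :: 'a poly) i = (if k = Idx_B i then 1 else 0)"
    "coeff (delta_psi k :: 'a poly) i = (if k = Idx_psi i then 1 else 0)" for k
    by (cases k; simp)+
  show "coeff (\<Sum>k\<in>S. smult (u k) (delta_A k)) i = (if Idx_A i \<in> S then u (Idx_A i) else 0)"
    and "coeff (\<Sum>k\<in>S. smult (u k) (delta_B k)) i = (if Idx_B i \<in> S then u (Idx_B i) else 0)"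
    and "coeff (\<Sum>k\<in>S. smult (u k) (delta_psi k)) i = (if Idx_psi i \<in> S then u (Idx_psi i) else 0)"
    using assms by (simp_all add: coeff_sum * if_distrib sum.delta cong: if_cong)
qed

lemma sum_delta_eq_0D:
  assumes "finite S" "k \<in> S"
    and "(\<Sum>k\<in>S. smult (u k) (delta_A k)) = 0"
    and "(\<Sum>k\<in>S. smult (u k) (delta_B k)) = 0"
    and "(\<Sum>k\<in>S. smult (u k) (delta_psi k)) = 0"
  shows "u k = 0"
  using assms coeff_sum_delta[OF assms(1), of u] by (cases k) (auto, (metis coeff_0)+)

text \<open>The last formula is -x \<otimes> 1 - y \<otimes> t = -x \<otimes> 1 - (y \<otimes> t + z
  \<otimes> s) + z \<otimes> s, multiplied by s^i.\<close>

lemma dd_eq_uu: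
  "A_dd i = - A_uu i"
  "B_dd i = - B_uu i"
  "psi_dd (i + 1) = - A_uu i - B_uu i + psi_uu (i + 1)"
  by (simp_all add: A_dd_def B_dd_def psi_dd_def A_uu_def B_uu_def psi_uu_def loop_defs algebra_simps)

text \<open>The change of basis is an involution: substituting the previous formulas into the
  right-hand sides cancels everything else.\<close>

lemma uu_eq_dd:
  "A_uu i = - A_dd i"
  "B_uu i = - B_dd i"
  "psi_uu (i + 1) = - A_dd i - B_dd i + psi_dd (i + 1)"
  unfolding dd_eq_uu by simp_all

section \<open>Both families in polynomial coordinates\<close>

lemma basis_0312_eq: "basis_0312 k = loop_of_polys (delta_A k) (delta_B k) (delta_psi k)"
  by (cases k) (simp_all add: loop_of_polys_def A_uu_def B_uu_def psi_uu_def poly_t_minus_1_monom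
      loop_defs)

lemma basis_3021_eq:
  "basis_3021 k = loop_of_polys (- delta_A k - delta_psi k) (- delta_B k - delta_psi k) (delta_psi k)"
  by (cases k) (simp_all add: dd_eq_uu[simplified] loop_of_polys_def A_uu_def B_uu_def psi_uu_def
      poly_t_minus_1_minus poly_t_minus_1_monom loop_defs)

lemma independent_0312:
  "inj (basis_0312 :: onsager_index \<Rightarrow> 'a :: field_char_0 loop_sl2)"
  "loop.independent (range (basis_0312 :: onsager_index \<Rightarrow> 'a loop_sl2))"
proof -
  have *: "u k = 0"
    if "finite S" "(\<Sum>k\<in>S. scale_loop (u k) (basis_0312 k)) = 0" "k \<in> S"
    for S and u :: "onsager_index \<Rightarrow> 'a" and k
    using loop_of_polys_eq_0D[OF that(2)[unfolded basis_0312_eq loop_of_polys_sum]]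
    by (rule sum_delta_eq_0D[OF that(1,3)])
  show "inj (basis_0312 :: onsager_index \<Rightarrow> 'a loop_sl2)"
    "loop.independent (range (basis_0312 :: onsager_index \<Rightarrow> 'a loop_sl2))"
    by (rule loop.independent_family, fact *)+
qed

lemma independent_3021:
  "inj (basis_3021 :: onsager_index \<Rightarrow> 'a :: field_char_0 loop_sl2)"
  "loop.independent (range (basis_3021 :: onsager_index \<Rightarrow> 'a loop_sl2))"
proof -
  have *: "u k = 0"
    if "finite S" "(\<Sum>k\<in>S. scale_loop (u k) (basis_3021 k)) = 0" "k \<in> S"
    for S and u :: "onsager_index \<Rightarrow> 'a" and k
  proof (rule sum_delta_eq_0D[OF that(1,3)])
    note zero = loop_of_polys_eq_0D[OF that(2)[unfolded basis_3021_eq loop_of_polys_sum]]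
    \<comment> \<open>The coordinates are triangular: the third involves \<open>delta_psi\<close>
      alone, so it vanishes first and then drops out of the other two.\<close>
    show psi: "(\<Sum>k\<in>S. smult (u k) (delta_psi k)) = 0"
      by (fact zero(3))
    show "(\<Sum>k\<in>S. smult (u k) (delta_A k)) = 0" "(\<Sum>k\<in>S. smult (u k) (delta_B k)) = 0"
      using zero(1,2) psi by (simp_all add: smult_diff_right sum_subtractf sum_negf)
  qed
  show "inj (basis_3021 :: onsager_index \<Rightarrow> 'a loop_sl2)"
    "loop.independent (range (basis_3021 :: onsager_index \<Rightarrow> 'a loop_sl2))"
    by (rule loop.independent_family, fact *)+
qed

section \<open>The span of the basis elements\<close>

text \<open>These are the equitable relations [x,y] = 2x + 2y, [y,z] = 2y + 2z, [z,x] = 2z + 2x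
  combined with t = s + 1. If the \<open>psi_uu\<close> on the left have positive index, so do those
  on the right, and \<open>psi_uu 0\<close> never enters the span.\<close>

lemma bracket_uu:
  "bracket (A_uu i) (A_uu j) = 0"
  "bracket (B_uu i) (B_uu j) = 0"
  "bracket (psi_uu i) (psi_uu j) = 0"
  "bracket (A_uu i) (B_uu j) =
     scale_loop 2 (A_uu (i + j) + B_uu (i + j)) - scale_loop 4 (psi_uu (i + j + 1))"
  "bracket (psi_uu i) (A_uu j) = scale_loop 2 (psi_uu (i + j) + A_uu (i + j))"
  "bracket (B_uu i) (psi_uu j) = scale_loop 2 (B_uu (i + j) + psi_uu (i + j))"
  by (simp_all add: A_uu_def B_uu_def psi_uu_def loop_defs of_scalar_numeral power_add algebra_simps)

section \<open>Closure of the span under the bracket\<close>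

lemma bracket_anticommute: "bracket v u = - bracket u v"
  by (simp add: sl2_defs algebra_simps)

lemma bracket_scale_loop:
  "bracket (scale_loop c u) v = scale_loop c (bracket u v)"
  "bracket u (scale_loop c v) = scale_loop c (bracket u v)"
  by (simp_all add: scale_loop_def bracket_lie)

lemma bracket_0: "bracket 0 v = 0" "bracket u 0 = 0"
  by (simp_all add: sl2_defs)

text \<open>Bilinearity extends closure from generators one argument at a time, first on the right
  and then on the left.\<close>

lemma bracket_in_span:
  assumes gen: "\<And>b c. b \<in> G \<Longrightarrow> c \<in> G \<Longrightarrow> bracket b c \<in> loop.span G"
    and u: "u \<in> loop.span G" and v: "v \<in> loop.span G"
  shows "bracket u v \<in> loop.span G"
proof -
  have left: "bracket b v \<in> loop.span G" if "b \<in> G" for b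
    using v
    by (induction rule: loop.span_induct_alt)
      (auto simp: bracket_lie(2) bracket_scale_loop bracket_0
        intro!: loop.span_add loop.span_scale loop.span_zero gen that)
  show ?thesis
    using u
    by (induction rule: loop.span_induct_alt)
      (auto simp: bracket_lie(1) bracket_scale_loop bracket_0
        intro!: loop.span_add loop.span_scale loop.span_zero left)
qed

lemma uu_in_span:
  "A_uu i \<in> loop.span (range basis_0312)"
  "B_uu i \<in> loop.span (range basis_0312)"
  "psi_uu (Suc i) \<in> loop.span (range basis_0312)"
  using loop.span_base[OF rangeI, of basis_0312 "Idx_A i"]
    loop.span_base[OF rangeI, of basis_0312 "Idx_B i"]
    loop.span_base[OF rangeI, of basis_0312 "Idx_psi i"]
  by simp_all

lemma bracket_basis_0312_in_span:
  "bracket (basis_0312 j) (basis_0312 k) \<in> loop.span (range basis_0312)"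
proof -
  note intros = loop.span_zero loop.span_add loop.span_diff loop.span_scale loop.span_neg uu_in_span
  have AB: "bracket (A_uu m) (B_uu n) \<in> loop.span (range basis_0312)"
    and PA: "bracket (psi_uu (Suc m)) (A_uu n) \<in> loop.span (range basis_0312)"
    and BP: "bracket (B_uu m) (psi_uu (Suc n)) \<in> loop.span (range basis_0312)" for m n
    by (auto simp: bracket_uu intro!: intros)
  have "bracket (B_uu m) (A_uu n) \<in> loop.span (range basis_0312)"
    and "bracket (A_uu m) (psi_uu (Suc n)) \<in> loop.span (range basis_0312)"
    and "bracket (psi_uu (Suc m)) (B_uu n) \<in> loop.span (range basis_0312)" for m n
    using loop.span_neg[OF AB[of n m]] loop.span_neg[OF PA[of n m]] loop.span_neg[OF BP[of n m]]
    by (simp_all only: bracket_anticommute[symmetric])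
  with AB PA BP show ?thesis
    by (cases j; cases k) (simp_all add: bracket_uu(1-3) loop.span_zero)
qed

lemma lie_subalgebra_span_0312: "lie_subalgebra (loop.span (range basis_0312))"
  unfolding lie_subalgebra_def
  by (auto intro!: bracket_in_span bracket_basis_0312_in_span)

section \<open>Comparison with the Onsager algebra\<close>

lemma onsager_generators: "A_uu 0 = onsager_A" "B_uu 0 = onsager_B"
  by (simp_all add: A_uu_def B_uu_def onsager_A_def onsager_B_def loop_defs)

lemma onsager_subset_span: "onsager \<subseteq> loop.span (range basis_0312)"
  unfolding onsager_def
  by (rule hull_minimal)
    (auto simp: lie_subalgebra_span_0312 onsager_generators[symmetric] uu_in_span)

text \<open>The three memberships are proved by one induction: raising the index of
  \<open>A_uu i\<close> or \<open>B_uu i\<close> leaves a remainder in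
  \<open>psi_uu (Suc i)\<close>, which is itself obtained from \<open>A_uu i\<close>,
  \<open>B_uu i\<close> and \<open>B_uu 0\<close>.\<close>

lemma uu_in_onsager:
  "(A_uu i :: 'a :: field_char_0 loop_sl2) \<in> onsager
   \<and> (B_uu i :: 'a loop_sl2) \<in> onsager
   \<and> (psi_uu (Suc i) :: 'a loop_sl2) \<in> onsager"
proof -
  have sub: "loop.subspace (onsager :: 'a loop_sl2 set)"
    and brk: "\<And>u v :: 'a loop_sl2. u \<in> onsager \<Longrightarrow> v \<in> onsager \<Longrightarrow> bracket u v \<in> onsager"
    using onsager_lie_subalgebra by (auto simp: lie_subalgebra_def)
  note intros = loop.subspace_add[OF sub] loop.subspace_diff[OF sub] loop.subspace_scale[OF sub] brk
  \<comment> \<open>The brackets only yield multiples by 2 or 4; characteristic zero allows the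
    division.\<close>
  have cancel: "v \<in> onsager" if "scale_loop c v \<in> onsager" "c \<noteq> 0" for c and v :: "'a loop_sl2"
    using loop.subspace_scale[OF sub that(1), of "inverse c"] that(2) by simp
  have A0: "(A_uu 0 :: 'a loop_sl2) \<in> onsager" and B0: "(B_uu 0 :: 'a loop_sl2) \<in> onsager"
    unfolding onsager_generators onsager_def
    by (meson hull_inc insertI1 insertI2)+
  have psi: "(psi_uu (Suc i) :: 'a loop_sl2) \<in> onsager"
    if "(A_uu i :: 'a loop_sl2) \<in> onsager" "(B_uu i :: 'a loop_sl2) \<in> onsager" for i
  proof (rule cancel)
    have "scale_loop 4 (psi_uu (Suc i)) =
        scale_loop 2 (A_uu i + B_uu i) - bracket (A_uu i) (B_uu 0 :: 'a loop_sl2)"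
      by (simp add: bracket_uu)
    also have "\<dots> \<in> onsager"
      by (intro intros that B0)
    finally show "scale_loop 4 (psi_uu (Suc i) :: 'a loop_sl2) \<in> onsager" .
  qed simp
  have psi1: "(psi_uu (Suc 0) :: 'a loop_sl2) \<in> onsager"
    by (rule psi[OF A0 B0])
  show ?thesis
  proof (induction i)
    case 0
    show ?case using A0 B0 psi1 by blast
  next
    case (Suc i)
    have A: "(A_uu (Suc i) :: 'a loop_sl2) \<in> onsager"
    proof (rule cancel)
      have "scale_loop 2 (A_uu (Suc i)) =
          bracket (psi_uu (Suc 0)) (A_uu i :: 'a loop_sl2) - scale_loop 2 (psi_uu (Suc i))"
        by (simp add: bracket_uu loop.scale_right_distrib)
      also have "\<dots> \<in> onsager"
        using Suc psi1 by (intro intros) auto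
      finally show "scale_loop 2 (A_uu (Suc i) :: 'a loop_sl2) \<in> onsager" .
    qed simp
    have B: "(B_uu (Suc i) :: 'a loop_sl2) \<in> onsager"
    proof (rule cancel)
      have "scale_loop 2 (B_uu (Suc i)) =
          bracket (B_uu i) (psi_uu (Suc 0) :: 'a loop_sl2) - scale_loop 2 (psi_uu (Suc i))"
        by (simp add: bracket_uu loop.scale_right_distrib)
      also have "\<dots> \<in> onsager"
        using Suc psi1 by (intro intros) auto
      finally show "scale_loop 2 (B_uu (Suc i) :: 'a loop_sl2) \<in> onsager" .
    qed simp
    show ?case using A B psi[OF A B] by blast
  qed
qed

lemma span_0312: "loop.span (range basis_0312) = (onsager :: 'a :: field_char_0 loop_sl2 set)"
proof (rule antisym[OF _ onsager_subset_span])
  have "basis_0312 k \<in> (onsager :: 'a loop_sl2 set)" for k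
    by (cases k) (simp_all add: uu_in_onsager)
  then show "loop.span (range basis_0312) \<subseteq> (onsager :: 'a loop_sl2 set)"
    using onsager_lie_subalgebra by (intro loop.span_minimal) (auto simp: lie_subalgebra_def)
qed

section \<open>The span of the second family\<close>

lemma dd_in_span:
  "A_dd i \<in> loop.span (range basis_3021)"
  "B_dd i \<in> loop.span (range basis_3021)"
  "psi_dd (Suc i) \<in> loop.span (range basis_3021)"
  using loop.span_base[OF rangeI, of basis_3021 "Idx_A i"]
    loop.span_base[OF rangeI, of basis_3021 "Idx_B i"]
    loop.span_base[OF rangeI, of basis_3021 "Idx_psi i"]
  by simp_all

lemma span_3021_eq_span_0312: "loop.span (range basis_3021) = loop.span (range basis_0312)"
proof -
  have "basis_3021 k \<in> loop.span (range basis_0312)" for k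
    by (cases k) (auto simp: dd_eq_uu[simplified]
        intro!: loop.span_add loop.span_diff loop.span_neg uu_in_span)
  moreover have "basis_0312 k \<in> loop.span (range basis_3021)" for k
    by (cases k) (auto simp: uu_eq_dd[simplified]
        intro!: loop.span_add loop.span_diff loop.span_neg dd_in_span)
  ultimately show ?thesis
    by (auto simp: loop.span_eq)
qed

theorem lemma11p1:
  shows
    "basis_family_of (basis_0312 :: onsager_index \<Rightarrow> ('a :: field_char_0) loop_sl2) onsager
     \<and> basis_family_of (basis_3021 :: onsager_index \<Rightarrow> 'a loop_sl2) onsager
     \<and> (\<forall>i. (A_dd i :: 'a loop_sl2) = - A_uu i
          \<and> (B_dd i :: 'a loop_sl2) = - B_uu i
          \<and> (psi_dd (i + 1) :: 'a loop_sl2) = - A_uu i - B_uu i + psi_uu (i + 1))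
     \<and> (\<forall>i. (A_uu i :: 'a loop_sl2) = - A_dd i
          \<and> (B_uu i :: 'a loop_sl2) = - B_dd i
          \<and> (psi_uu (i + 1) :: 'a loop_sl2) = - A_dd i - B_dd i + psi_dd (i + 1))"
  unfolding basis_family_of_def span_3021_eq_span_0312 span_0312
  by (intro conjI allI refl independent_0312 independent_3021 dd_eq_uu uu_eq_dd)

end
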